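(* Let $S$ be a cancellative right amenable semigroup, $A$ an abelian group with torsion subgroup $t(A)$, and $S\overset{\alpha}{\curvearrowright}A$ a left action by group endomorphisms. Then $$\mathrm{ent}(\alpha)=\mathrm{ent}(\alpha_{t(A)})=h_{alg}(\alpha_{t(A)}).$$
   Context: A semigroup $S$ is cancellative if all left and right multiplications are injective. $S$ is right amenable if there is a finitely additive $\mu:\mathcal P(S)\to[0,1]$ with $\mu(S)=1$ and $\mu(R_s^{-1}(F))=\mu(F)$ for all $s\in S$, $F\subseteq S$, where $R_s(x)=xs$. A right Følner net of $S$ is a net $(F_i)_{i\in I}$ of non-empty finite subsets of $S$ with $\lim_{i\in I}|F_is\setminus F_i|/|F_i|=0$ for every $s\in S$ (such nets exist when $S$ is cancellative right amenable). A left action $S\overset{\alpha}{\curvearrowright}A$ assigns to each $s\in S$ an endomorphism $\alpha(s)$ of $A$ with $\alpha(st)=\alpha(s)\circ\alpha(t)$ (and $\alpha(1)=\mathrm{id}_A$ if $S$ is a monoid). The subgroup $t(A)$ is invariant under all $\alpha(s)$, and $\alpha_{t(A)}$ is the induced action of $S$ on $t(A)$. For non-empty finite $X\subseteq A$ and non-empty finite $F\subseteq S$ put $T_F(\alpha,X)=\sum_{s\in F}\alpha(s)(X)$ (sum of subsets). Set $H_{alg}(\alpha,X)=\lim_{i\in I}\frac{\log|T_{F_i}(\alpha,X)|}{|F_i|}$ for any right Følner net $(F_i)_{i\in I}$ of $S$; the limit is known to exist, to be finite, and not to depend on the net. Define $h_{alg}(\alpha)=\sup\{H_{alg}(\alpha,X):X\subseteq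 A\text{ non-empty finite}\}$ and $\mathrm{ent}(\alpha)=\sup\{H_{alg}(\alpha,X):X\text{ a finite subgroup of }A\}$, both in $[0,\infty]$. *)

theory Defs
  imports Complex_Main "HOL-Library.Set_Algebras" "HOL-Library.Extended_Real"
begin

definition cancellative :: "'s::semigroup_mult itself \<Rightarrow> bool" where
  "cancellative _ \<longleftrightarrow> (\<forall>s::'s. inj (\<lambda>x. s * x) \<and> inj (\<lambda>x. x * s))"

definition right_amenable :: "'s::semigroup_mult itself \<Rightarrow> bool" where
  "right_amenable _ \<longleftrightarrow>
     (\<exists>\<mu> :: 's set \<Rightarrow> real.
        (\<forall>E. 0 \<le> \<mu> E \<and> \<mu> E \<le> 1) \<and>
        (\<forall>E F. E \<inter> F = {} \<longrightarrow> \<mu> (E \<union> F) = \<mu> E + \<mu> F) \<and>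
        \<mu> UNIV = 1 \<and>
        (\<forall>s E. \<mu> ((\<lambda>x. x * s) -` E) = \<mu> E))"

text \<open>
  A net of finite subsets of the semigroup is represented by the filter on subsets generated by
  its tails: every net induces such a filter, every proper filter arises from a net, and limits
  of \<open>f (F i)\<close> along the net are limits of \<open>f\<close> along the filter.  This avoids quantifying over
  index types.
\<close>
definition right_Folner :: "'s::semigroup_mult set filter \<Rightarrow> bool" where
  "right_Folner N \<longleftrightarrow>
     N \<noteq> bot \<and>
     (\<forall>\<^sub>F F in N. finite F \<and> F \<noteq> {}) \<and>
     (\<forall>s. ((\<lambda>F. real (card ((\<lambda>x. x * s) ` F - F)) / real (card F)) \<longlongrightarrow> 0) N)"

definition add_subgroup :: "'a::ab_group_add set \<Rightarrow> bool" where
  "add_subgroup B \<longleftrightarrow> 0 \<in> B \<and> (\<forall>x\<in>B. \<forall>y\<in>B. x + y \<in> B) \<and> (\<forall>x\<in>B. - x \<in> B)"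

text \<open>The sum below is the multiple \<open>n x\<close>.\<close>
definition torsion :: "'a::ab_group_add set" where
  "torsion = {x. \<exists>n>0. (\<Sum>i<n::nat. x) = 0}"

text \<open>
  Actions on a subgroup \<open>B\<close> of the ambient group are given by maps on the ambient type of which
  only the values on \<open>B\<close> matter; thus the action induced by \<open>\<alpha>\<close> on an invariant subgroup \<open>B\<close>
  is \<open>\<alpha>\<close> itself, considered on \<open>B\<close>.
\<close>
definition left_action ::
    "'a::ab_group_add set \<Rightarrow> ('s::semigroup_mult \<Rightarrow> 'a \<Rightarrow> 'a) \<Rightarrow> bool" where
  "left_action B \<alpha> \<longleftrightarrow>
     (\<forall>s. \<forall>x\<in>B. \<alpha> s x \<in> B) \<and>
     (\<forall>s. \<forall>x\<in>B. \<forall>y\<in>B. \<alpha> s (x + y) = \<alpha> s x + \<alpha> s y) \<and>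
     (\<forall>s t. \<forall>x\<in>B. \<alpha> (s * t) x = \<alpha> s (\<alpha> t x)) \<and>
     (\<forall>e. (\<forall>s. e * s = s \<and> s * e = s) \<longrightarrow> (\<forall>x\<in>B. \<alpha> e x = x))"

text \<open>The sum is the elementwise sum of subsets.\<close>
definition trajectory ::
    "('s \<Rightarrow> 'a::ab_group_add \<Rightarrow> 'a) \<Rightarrow> 'a set \<Rightarrow> 's set \<Rightarrow> 'a set" where
  "trajectory \<alpha> X F = (\<Sum>s\<in>F. \<alpha> s ` X)"

text \<open>The common limit along all right Folner nets.\<close>
definition H_alg ::
    "('s::semigroup_mult \<Rightarrow> 'a::ab_group_add \<Rightarrow> 'a) \<Rightarrow> 'a set \<Rightarrow> real" where
  "H_alg \<alpha> X =
     (THE h. \<forall>N. right_Folner N \<longrightarrow>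
        ((\<lambda>F. ln (real (card (trajectory \<alpha> X F))) / real (card F)) \<longlongrightarrow> h) N)"

definition h_alg ::
    "'a::ab_group_add set \<Rightarrow> ('s::semigroup_mult \<Rightarrow> 'a \<Rightarrow> 'a) \<Rightarrow> ereal" where
  "h_alg B \<alpha> = (SUP X\<in>{X. finite X \<and> X \<noteq> {} \<and> X \<subseteq> B}. ereal (H_alg \<alpha> X))"

definition ent ::
    "'a::ab_group_add set \<Rightarrow> ('s::semigroup_mult \<Rightarrow> 'a \<Rightarrow> 'a) \<Rightarrow> ereal" where
  "ent B \<alpha> = (SUP X\<in>{X. finite X \<and> add_subgroup X \<and> X \<subseteq> B}. ereal (H_alg \<alpha> X))"

lemma add_subgroup_torsion: "add_subgroup (torsion :: 'a::ab_group_add set)"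
proof -
  have split: "(\<Sum>i<n + m. x) = (\<Sum>i<n. x) + (\<Sum>i<m. x)" for n m :: nat and x :: 'a
    by (induction m) (simp_all add: add.assoc)
  have mult: "(\<Sum>i<n * m. x) = 0" if "(\<Sum>i<n. x) = 0" for n m :: nat and x :: 'a
    using that by (induction m) (simp_all add: split)
  have "x + y \<in> torsion" if xy: "x \<in> torsion" "y \<in> torsion" for x y :: 'a
  proof -
    from xy obtain n m :: nat
      where nm: "n > 0" "(\<Sum>i<n. x) = 0" "m > 0" "(\<Sum>i<m. y) = 0"
      unfolding torsion_def by blast
    have "(\<Sum>i<n * m. x + y) = 0"
      using mult[OF nm(2), of m] mult[OF nm(4), of n] by (simp add: sum.distrib mult.commute)
    with nm show ?thesis unfolding torsion_def by (auto intro!: exI[of _ "n * m"])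
  qed
  then show ?thesis
    unfolding add_subgroup_def torsion_def by (auto simp: sum_negf intro: exI[of _ "1::nat"])
qed

lemma left_action_torsion:
  assumes "left_action UNIV \<alpha>"
  shows "left_action torsion \<alpha>"
proof -
  have add: "\<alpha> s (x + y) = \<alpha> s x + \<alpha> s y" for s x y
    using assms unfolding left_action_def by blast
  then have zero: "\<alpha> s 0 = 0" for s
    by (metis add_cancel_right_right)
  have sum: "\<alpha> s (\<Sum>i<n. x) = (\<Sum>i<n. \<alpha> s x)" for s x and n :: nat
    by (induction n) (simp_all add: zero add)
  have "\<alpha> s x \<in> torsion" if "x \<in> torsion" for s x
    using that unfolding torsion_def by (auto simp: sum[symmetric] zero)
  then show ?thesis
    using assms unfolding left_action_def by blast
qed

end

theory Submission
  imports Defs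
begin

text \<open>
  Finite subgroups consist of torsion elements, and a finite set of torsion elements lies in a
  finite subgroup, so everything follows from monotonicity of \<open>H_alg\<close> in \<open>X\<close>, once the defining
  limit is known to exist.  Its existence is shown without quasi-tilings: the function
  \<open>F \<mapsto> ln |T\<^sub>F|\<close> is fractionally subadditive (a Shearer inequality for sumsets), in the form that
  \<open>ln |T\<^sub>F|\<close> can be distributed over \<open>F\<close> as non-negative weights whose sum over any
  \<open>C \<subseteq> F\<close> is at most \<open>ln |T\<^sub>C|\<close>.  Summing these weights over the translates \<open>s E\<close>, \<open>s \<in> F\<close>, which
  cover almost every point of a Folner set \<open>F\<close> exactly \<open>|E|\<close> times, gives
  \<open>ln |T\<^sub>F| / |F| \<le> ln |T\<^sub>E| / |E| + o(1)\<close>, so the limit is the infimum over all \<open>E\<close>.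
\<close>

section \<open>Logarithmic sizes of sumsets and their fractional subadditivity\<close>

text \<open>Gibbs' inequality: the entropy of \<open>p\<close> plus the \<open>p\<close>-average of
  \<open>ln (n i)\<close> is largest when \<open>p\<close> is proportional to \<open>n\<close>. It
  comes from \<open>ln x \<le> x - 1\<close> at \<open>x = n i / (p i * m)\<close>, averaged with
  weights \<open>p\<close>.\<close>

lemma sum_mult_ln_divide_le:
  fixes p n :: "'i \<Rightarrow> real"
  assumes "finite I" "I \<noteq> {}" and pos: "\<And>i. i \<in> I \<Longrightarrow> p i > 0" "\<And>i. i \<in> I \<Longrightarrow> n i > 0"
    and sum1: "(\<Sum>i\<in>I. p i) = 1"
  shows "(\<Sum>i\<in>I. p i * (ln (n i) - ln (p i))) \<le> ln (\<Sum>i\<in>I. n i)"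
proof -
  define m where "m = (\<Sum>i\<in>I. n i)"
  have m: "m > 0" unfolding m_def using assms by (intro sum_pos) auto
  have "p i * (ln (n i) - ln (p i)) \<le> p i * ln m + (n i / m - p i)" if i: "i \<in> I" for i
  proof -
    have "ln (n i / (p i * m)) \<le> n i / (p i * m) - 1"
      using pos i m by (intro ln_le_minus_one) auto
    then have "p i * (ln (n i) - ln (p i) - ln m) \<le> p i * (n i / (p i * m) - 1)"
      using pos[OF i] m by (intro mult_left_mono) (auto simp: ln_div ln_mult)
    also have "\<dots> = n i / m - p i"
      using pos(1)[OF i] m by (simp add: field_simps)
    finally show ?thesis by (simp add: algebra_simps)
  qed
  then have "(\<Sum>i\<in>I. p i * (ln (n i) - ln (p i))) \<le> (\<Sum>i\<in>I. p i * ln m + (n i / m - p i))"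
    by (rule sum_mono)
  also have "\<dots> = (\<Sum>i\<in>I. p i) * ln m + ((\<Sum>i\<in>I. n i) / m - (\<Sum>i\<in>I. p i))"
    by (simp add: sum.distrib sum_subtractf sum_distrib_right sum_divide_distrib)
  also have "\<dots> = ln m" using m sum1 by (simp add: m_def)
  finally show ?thesis by (simp add: m_def)
qed

lemma finite_set_sum:
  fixes Y :: "'t \<Rightarrow> 'a::comm_monoid_add set"
  assumes "\<And>t. t \<in> F \<Longrightarrow> finite (Y t)"
  shows "finite (sum Y F)"
  using assms by (induction F rule: infinite_finite_induct) (auto intro: finite_set_plus)

lemma set_sum_nonempty:
  fixes Y :: "'t \<Rightarrow> 'a::comm_monoid_add set"
  assumes "\<And>t. t \<in> F \<Longrightarrow> Y t \<noteq> {}"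
  shows "sum Y F \<noteq> {}"
  using assms by (induction F rule: infinite_finite_induct) (auto simp: set_plus_def)

lemma card_set_sum_pos:
  fixes Y :: "'t \<Rightarrow> 'a::comm_monoid_add set"
  assumes "\<And>t. t \<in> F \<Longrightarrow> finite (Y t) \<and> Y t \<noteq> {}"
  shows "card (sum Y F) > 0"
  using finite_set_sum[of F Y] set_sum_nonempty[of F Y] assms by (simp add: card_gt_0_iff)

text \<open>The sets need not contain 0, so \<open>sum Y C\<close> need not lie in
  \<open>sum Y F\<close>; translating by a fixed element of the sum over \<open>F - C\<close> embeds
  it.\<close>

lemma card_set_sum_mono:
  fixes Y :: "'t \<Rightarrow> 'a::ab_group_add set"
  assumes "finite F" "C \<subseteq> F" and Y: "\<And>t. t \<in> F \<Longrightarrow> finite (Y t) \<and> Y t \<noteq> {}"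
  shows "card (sum Y C) \<le> card (sum Y F)"
proof -
  from set_sum_nonempty[of "F - C" Y] Y obtain r where r: "r \<in> sum Y (F - C)" by auto
  have "sum Y F = sum Y (F - C) + sum Y C"
    using assms by (intro sum.subset_diff) auto
  then have "(+) r ` sum Y C \<subseteq> sum Y F" using r by auto
  moreover have "finite (sum Y F)" using Y by (intro finite_set_sum) auto
  ultimately have "card ((+) r ` sum Y C) \<le> card (sum Y F)" by (rule card_mono[rotated])
  then show ?thesis by (simp add: card_image)
qed

text \<open>
  \<open>shadow Y F Z C\<close> plays the role of the projection of \<open>Z\<close> to the coordinates in \<open>C\<close>.
\<close>
definition shadow ::
    "('t \<Rightarrow> 'a::ab_group_add set) \<Rightarrow> 't set \<Rightarrow> 'a set \<Rightarrow> 't set \<Rightarrow> 'a set" where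
  "shadow Y F Z C = {v \<in> sum Y C. \<exists>r\<in>sum Y (F - C). v + r \<in> Z}"

lemma shadow_nonempty:
  assumes "finite F" "C \<subseteq> F" "Z \<subseteq> sum Y F" "Z \<noteq> {}"
  shows "shadow Y F Z C \<noteq> {}"
proof -
  from assms obtain z where z: "z \<in> Z" "z \<in> sum Y F" by auto
  have "sum Y F = sum Y (F - C) + sum Y C"
    using assms by (intro sum.subset_diff) auto
  with z obtain r v where "z = r + v" "r \<in> sum Y (F - C)" "v \<in> sum Y C"
    by (auto elim: set_plus_elim)
  with z show ?thesis unfolding shadow_def by (auto simp: add.commute intro!: exI[of _ v])
qed

lemma finite_shadow:
  assumes "C \<subseteq> F" "\<And>t. t \<in> F \<Longrightarrow> finite (Y t)"
  shows "finite (shadow Y F Z C)"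
proof (rule finite_subset)
  show "shadow Y F Z C \<subseteq> sum Y C" by (auto simp: shadow_def)
  show "finite (sum Y C)" using assms by (intro finite_set_sum) auto
qed

text \<open>Induction on \<open>F\<close> imitating the chain rule for entropy: \<open>Z\<close> is
  cut into slices according to the summand taken from the new set \<open>Y t\<close>, and the
  weights of the slices are averaged. Slices are rarely full sumsets, which is why \<open>Z\<close>
  is an arbitrary subset.\<close>

lemma shadow_weights:
  fixes Y :: "'t \<Rightarrow> 'a::ab_group_add set"
  assumes "finite F" "\<And>t. t \<in> F \<Longrightarrow> finite (Y t)" "Z \<subseteq> sum Y F" "Z \<noteq> {}"
  shows "\<exists>w. (\<forall>t\<in>F. w t \<ge> 0) \<and> sum w F = ln (real (card Z)) \<and>
    (\<forall>C\<subseteq>F. sum w C \<le> ln (real (card (shadow Y F Z C))))"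
  using assms
proof (induction F arbitrary: Z rule: finite_induct)
  case empty
  then have "Z = {0}" by auto
  then show ?case by (auto simp: shadow_def)
next
  case (insert t F)
  note fin = insert.prems(1)
  have Zsub: "Z \<subseteq> Y t + sum Y F" using insert by simp
  have finZ: "finite Z"
    using finite_set_sum[of "insert t F" Y] insert.prems finite_subset by blast
  \<comment> \<open>The map \<open>g\<close> orders \<open>Y t\<close> linearly. Choosing the
    \<open>g\<close>-least admissible summand gives each element of \<open>Z\<close> a canonical
    decomposition; minimality later makes translated shadows disjoint.\<close>
  obtain g :: "'a \<Rightarrow> nat" where g: "inj_on g (Y t)"
    using finite_imp_inj_to_nat_seg[of "Y t"] fin by auto
  define first where "first z y \<longleftrightarrow> y \<in> Y t \<and> z - y \<in> sum Y F \<and>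
    (\<forall>y'\<in>Y t. z - y' \<in> sum Y F \<longrightarrow> g y \<le> g y')" for z y
  have ex: "\<exists>y. first z y" if z: "z \<in> Z" for z
  proof -
    obtain y0 where y0: "y0 \<in> Y t" "z - y0 \<in> sum Y F"
      using z Zsub by (fastforce elim!: set_plus_elim)
    show ?thesis
      using ex_has_least_nat[of "\<lambda>y. y \<in> Y t \<and> z - y \<in> sum Y F" y0 g] y0
      unfolding first_def by auto
  qed
  define \<xi> where "\<xi> z = (SOME y. first z y)" for z
  have first: "first z (\<xi> z)" if "z \<in> Z" for z
    unfolding \<xi>_def using ex[OF that] by (rule someI_ex)
  define I where "I = \<xi> ` Z"
  define S where "S y = {z - y | z. z \<in> Z \<and> \<xi> z = y}" for y
  have finI: "finite I" and neI: "I \<noteq> {}"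
    unfolding I_def using finZ insert.prems by auto
  have S_ne: "S y \<noteq> {}" if "y \<in> I" for y
    using that unfolding S_def I_def by auto
  have S_sub: "S y \<subseteq> sum Y F" for y
    unfolding S_def using first first_def by auto
  have finS: "finite (S y)" for y
    using finite_subset[OF S_sub] fin finite_set_sum[of F Y] by auto
  \<comment> \<open>This is the distribution of the canonical first summand of a uniformly random
    element of \<open>Z\<close>.\<close>
  define p where "p y = real (card (S y)) / real (card Z)" for y
  have cZ: "card Z > 0" using finZ insert.prems by (simp add: card_gt_0_iff)
  have cS: "card (S y) > 0" if "y \<in> I" for y
    using finS S_ne[OF that] by (simp add: card_gt_0_iff)
  have p_pos: "p y > 0" if "y \<in> I" for y
    unfolding p_def using cS[OF that] cZ by simp
  have card_S: "card (S y) = card {z \<in> Z. \<xi> z = y}" for y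
  proof -
    have "S y = (\<lambda>z. z - y) ` {z \<in> Z. \<xi> z = y}" unfolding S_def by auto
    then show ?thesis by (simp add: card_image inj_on_def)
  qed
  have "card Z = (\<Sum>y\<in>I. card {z \<in> Z. \<xi> z = y})"
    using card_eq_sum sum.image_gen[OF finZ, of "\<lambda>_. 1::nat" \<xi>]
    by (simp add: I_def)
  then have sum_card: "real (card Z) = (\<Sum>y\<in>I. real (card (S y)))"
    by (simp add: card_S)
  have p1: "(\<Sum>y\<in>I. p y) = 1"
    unfolding p_def using cZ by (simp add: sum_card[symmetric] flip: sum_divide_distrib)
  have p_le: "p y \<le> 1" if "y \<in> I" for y
    using member_le_sum[of y I p] that finI p1 p_pos by (simp add: less_imp_le)
  have "\<forall>y\<in>I. \<exists>w. (\<forall>s\<in>F. w s \<ge> 0) \<and> sum w F = ln (real (card (S y))) \<and>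
    (\<forall>C\<subseteq>F. sum w C \<le> ln (real (card (shadow Y F (S y) C))))"
    using insert.IH[OF fin S_sub S_ne] by auto
  then obtain W where W: "\<And>y s. y \<in> I \<Longrightarrow> s \<in> F \<Longrightarrow> W y s \<ge> (0::real)"
    "\<And>y. y \<in> I \<Longrightarrow> sum (W y) F = ln (real (card (S y)))"
    "\<And>y C. y \<in> I \<Longrightarrow> C \<subseteq> F \<Longrightarrow> sum (W y) C \<le> ln (real (card (shadow Y F (S y) C)))"
    by metis
  \<comment> \<open>The new index \<open>t\<close> receives the entropy of the first summand, the
    old indices the expected weights from the slices.\<close>
  define w where "w s = (if s = t then (\<Sum>y\<in>I. p y * - ln (p y)) else (\<Sum>y\<in>I. p y * W y s))" for s
  have w_sum: "sum w C = (\<Sum>y\<in>I. p y * sum (W y) C)" if "C \<subseteq> F" for C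
  proof -
    have "sum w C = (\<Sum>s\<in>C. \<Sum>y\<in>I. p y * W y s)"
      using that insert.hyps by (intro sum.cong) (auto simp: w_def)
    then show ?thesis by (simp add: sum.swap[of _ I] sum_distrib_left)
  qed
  have w_sum': "sum w (insert t C) = (\<Sum>y\<in>I. p y * (sum (W y) C - ln (p y)))" if "C \<subseteq> F" for C
  proof -
    have "finite C" "t \<notin> C" using that insert.hyps finite_subset by auto
    then have "sum w (insert t C) = w t + sum w C" by simp
    also have "\<dots> = (\<Sum>y\<in>I. p y * (sum (W y) C - ln (p y)))"
      unfolding w_sum[OF that] by (simp add: w_def algebra_simps sum_subtractf sum_negf)
    finally show ?thesis .
  qed
  have sh_pos: "card (shadow Y F (S y) C) > 0" if "y \<in> I" "C \<subseteq> F" for y C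
    using finite_shadow[of C F Y "S y"] shadow_nonempty[of F C "S y" Y] S_sub S_ne fin that insert.hyps
    by (simp add: card_gt_0_iff)
  have "w s \<ge> 0" if "s \<in> insert t F" for s
  proof (cases "s = t")
    case True
    then show ?thesis
      unfolding w_def using p_pos p_le
      by (auto intro!: sum_nonneg mult_nonneg_nonpos simp: less_imp_le ln_le_zero_iff)
  next
    case False
    then show ?thesis
      unfolding w_def using p_pos W(1) that by (auto intro!: sum_nonneg simp: less_imp_le)
  qed
  moreover have "sum w (insert t F) = ln (real (card Z))"
  proof -
    \<comment> \<open>Chain rule: since \<open>p y\<close> is the relative size of the slice, this
      term is the same for every \<open>y\<close>.\<close>
    have "sum (W y) F - ln (p y) = ln (real (card Z))" if "y \<in> I" for y
      using W(2)[OF that] cS[OF that] cZ by (simp add: p_def ln_div)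
    then have "sum w (insert t F) = (\<Sum>y\<in>I. p y * ln (real (card Z)))"
      by (simp add: w_sum')
    then show ?thesis by (simp add: p1 flip: sum_distrib_right)
  qed
  moreover have "sum w C \<le> ln (real (card (shadow Y (insert t F) Z C)))" if C: "C \<subseteq> insert t F" for C
  proof (cases "t \<in> C")
    case False
    with C have CF: "C \<subseteq> F" by auto
    \<comment> \<open>For \<open>t\<close> outside \<open>C\<close> the summand \<open>y\<close>
      joins the remainder \<open>r\<close>, so a single slice already gives the bound, and averaging
      preserves it.\<close>
    have "shadow Y F (S y) C \<subseteq> shadow Y (insert t F) Z C" if y: "y \<in> I" for y
    proof
      fix v assume "v \<in> shadow Y F (S y) C"
      then obtain r z where v: "v \<in> sum Y C" "r \<in> sum Y (F - C)" "v + r = z - y" "z \<in> Z" "\<xi> z = y"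
        unfolding shadow_def S_def by auto
      have "y \<in> Y t" using first[OF v(4)] v(5) unfolding first_def by auto
      moreover have "insert t F - C = insert t (F - C)" using False by auto
      ultimately have "y + r \<in> sum Y (insert t F - C)"
        using insert.hyps v(2) by auto
      moreover have "v + (y + r) = z" using v(3) by (metis add.left_commute diff_add_cancel add.commute)
      ultimately show "v \<in> shadow Y (insert t F) Z C"
        unfolding shadow_def using v by blast
    qed
    then have le: "card (shadow Y F (S y) C) \<le> card (shadow Y (insert t F) Z C)" if "y \<in> I" for y
      using that fin C by (intro card_mono finite_shadow) auto
    have "sum w C \<le> (\<Sum>y\<in>I. p y * ln (real (card (shadow Y (insert t F) Z C))))"
      unfolding w_sum[OF CF]
    proof (intro sum_mono mult_left_mono)
      fix y assume y: "y \<in> I"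
      show "sum (W y) C \<le> ln (real (card (shadow Y (insert t F) Z C)))"
        using W(3)[OF y CF] le[OF y] sh_pos[OF y CF]
        by (smt (verit) ln_le_cancel_iff of_nat_0_less_iff of_nat_le_iff)
    qed (use p_pos in \<open>auto simp: less_imp_le\<close>)
    then show ?thesis by (simp add: p1 flip: sum_distrib_right)
  next
    case True
    define D where "D = C - {t}"
    have DF: "D \<subseteq> F" and CD: "C = insert t D" and tD: "t \<notin> D"
      using C True by (auto simp: D_def)
    have finD: "finite D" using DF insert.hyps finite_subset by auto
    have diff: "insert t F - C = F - D" using CD insert.hyps by auto
    \<comment> \<open>For \<open>t\<close> in \<open>C\<close> the summand \<open>y\<close> joins
      the visible part instead, so the shadow of the slice appears translated by
      \<open>y\<close>.\<close>
    have sub: "(+) y ` shadow Y F (S y) D \<subseteq> shadow Y (insert t F) Z C" if y: "y \<in> I" for y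
    proof safe
      fix v assume "v \<in> shadow Y F (S y) D"
      then obtain r z where v: "v \<in> sum Y D" "r \<in> sum Y (F - D)" "v + r = z - y" "z \<in> Z" "\<xi> z = y"
        unfolding shadow_def S_def by auto
      have "y \<in> Y t" using first[OF v(4)] v(5) unfolding first_def by auto
      then have "y + v \<in> sum Y C" using CD finD tD v(1) by auto
      moreover have "y + v + r = z" using v(3) by (simp add: add.assoc)
      ultimately show "y + v \<in> shadow Y (insert t F) Z C"
        unfolding shadow_def using v diff by auto
    qed
    text \<open>
      If \<open>y + v = y' + v'\<close> with \<open>y\<close> before \<open>y'\<close>, then replacing \<open>y'\<close>, \<open>v'\<close> by \<open>y\<close>, \<open>v\<close> in a
      representation of an element with first summand \<open>y'\<close> contradicts minimality of \<open>y'\<close>.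
    \<close>
    have le: "g y' \<le> g y"
      if y: "y \<in> I" "y' \<in> I" and v: "v \<in> shadow Y F (S y) D" "v' \<in> shadow Y F (S y') D"
        and eq: "y + v = y' + v'" for y y' v v'
    proof -
      obtain r z where r: "r \<in> sum Y (F - D)" "v' + r = z - y'" "z \<in> Z" "\<xi> z = y'"
        using v(2) unfolding shadow_def S_def by auto
      have "v \<in> sum Y D" using v(1) unfolding shadow_def by auto
      then have "r + v \<in> sum Y (F - D) + sum Y D" using r by auto
      then have "r + v \<in> sum Y F"
        using sum.subset_diff[OF DF insert.hyps(1), of Y] by simp
      moreover have "z - y = r + v"
        using eq r(2) by (metis add.commute add.left_commute diff_add_cancel add_diff_cancel_left')
      moreover have "y \<in> Y t" using y first unfolding I_def first_def by auto
      ultimately show ?thesis using first[OF r(3)] r(4) unfolding first_def by auto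
    qed
    have disj: "(+) y ` shadow Y F (S y) D \<inter> (+) y' ` shadow Y F (S y') D = {}"
      if y: "y \<in> I" "y' \<in> I" "y \<noteq> y'" for y y'
    proof (rule ccontr)
      assume "\<not> ?thesis"
      then obtain v v' where v: "v \<in> shadow Y F (S y) D" "v' \<in> shadow Y F (S y') D" "y + v = y' + v'"
        by auto
      have "g y = g y'"
        using le[OF y(1,2) v] le[OF y(2,1) v(2,1) v(3)[symmetric]] by simp
      moreover have "y \<in> Y t" "y' \<in> Y t" using y first unfolding I_def first_def by auto
      ultimately show False using g y(3) by (auto dest: inj_onD)
    qed
    have finsh: "finite (shadow Y F (S y) D)" for y
      using fin DF by (intro finite_shadow) auto
    have "(\<Sum>y\<in>I. card (shadow Y F (S y) D)) = (\<Sum>y\<in>I. card ((+) y ` shadow Y F (S y) D))"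
      by (simp add: card_image)
    also have "\<dots> = card (\<Union>y\<in>I. (+) y ` shadow Y F (S y) D)"
      using finI finsh disj by (intro card_UN_disjoint[symmetric]) auto
    also have "\<dots> \<le> card (shadow Y (insert t F) Z C)"
      using sub fin C by (intro card_mono finite_shadow) auto
    finally have total: "(\<Sum>y\<in>I. real (card (shadow Y F (S y) D))) \<le> real (card (shadow Y (insert t F) Z C))"
      by (simp flip: of_nat_sum)
    have "sum w C \<le> (\<Sum>y\<in>I. p y * (ln (real (card (shadow Y F (S y) D))) - ln (p y)))"
      unfolding CD w_sum'[OF DF] using W(3)[OF _ DF] p_pos
      by (intro sum_mono mult_left_mono) (auto simp: less_imp_le)
    \<comment> \<open>Gibbs' inequality absorbs the entropy assigned to \<open>t\<close>;
      disjointness of the translates then bounds the sum of the shadow sizes.\<close>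
    also have "\<dots> \<le> ln (\<Sum>y\<in>I. real (card (shadow Y F (S y) D)))"
      using finI neI p_pos p1 sh_pos[OF _ DF] by (intro sum_mult_ln_divide_le) auto
    also have "\<dots> \<le> ln (real (card (shadow Y (insert t F) Z C)))"
    proof -
      have "(\<Sum>y\<in>I. real (card (shadow Y F (S y) D))) > 0"
        using finI neI sh_pos[OF _ DF] by (intro sum_pos) auto
      with total show ?thesis by simp
    qed
    finally show ?thesis .
  qed
  ultimately show ?case by blast
qed

text \<open>This is the case \<open>Z = sum Y F\<close>, where the shadow over \<open>C\<close> is
  bounded simply by \<open>sum Y C\<close>.\<close>

lemma set_sum_weights:
  fixes Y :: "'t \<Rightarrow> 'a::ab_group_add set"
  assumes "finite F" and Y: "\<And>t. t \<in> F \<Longrightarrow> finite (Y t) \<and> Y t \<noteq> {}"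
  obtains w where "\<And>t. t \<in> F \<Longrightarrow> w t \<ge> 0" "sum w F = ln (real (card (sum Y F)))"
    "\<And>C. C \<subseteq> F \<Longrightarrow> sum w C \<le> ln (real (card (sum Y C)))"
proof -
  obtain w where w: "\<forall>t\<in>F. w t \<ge> 0" "sum w F = ln (real (card (sum Y F)))"
    "\<forall>C\<subseteq>F. sum w C \<le> ln (real (card (shadow Y F (sum Y F) C)))"
    using shadow_weights[of F Y "sum Y F"] set_sum_nonempty[of F Y] assms by auto
  have "sum w C \<le> ln (real (card (sum Y C)))" if C: "C \<subseteq> F" for C
  proof -
    have "card (shadow Y F (sum Y F) C) > 0"
      using finite_shadow[OF C, of Y] shadow_nonempty[OF assms(1) C, of "sum Y F" Y]
        set_sum_nonempty[of F Y] Y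
      by (simp add: card_gt_0_iff)
    moreover have "card (shadow Y F (sum Y F) C) \<le> card (sum Y C)"
      using Y C by (intro card_mono finite_set_sum) (auto simp: shadow_def)
    ultimately have "ln (real (card (shadow Y F (sum Y F) C))) \<le> ln (real (card (sum Y C)))"
      by simp
    then show ?thesis using w(3) C order_trans by blast
  qed
  with w that show ?thesis by blast
qed

section \<open>Elementary bounds on trajectories and translates\<close>

lemma card_trajectory_pos:
  assumes "finite X" "X \<noteq> {}"
  shows "card (trajectory \<alpha> X F) > 0"
  unfolding trajectory_def using assms by (intro card_set_sum_pos) auto

lemma card_trajectory_mono:
  assumes "finite Y" "X \<subseteq> Y"
  shows "card (trajectory \<alpha> X F) \<le> card (trajectory \<alpha> Y F)"
proof (rule card_mono)
  show "finite (trajectory \<alpha> Y F)"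
    unfolding trajectory_def using assms by (intro finite_set_sum) auto
  show "trajectory \<alpha> X F \<subseteq> trajectory \<alpha> Y F"
    unfolding trajectory_def using assms(2)
    by (induction F rule: infinite_finite_induct) (simp_all add: set_plus_mono2 image_mono)
qed

text \<open>The trajectory over the translate is the image under \<open>\<alpha> s\<close> of the
  one over \<open>E\<close>. An endomorphism may identify points, hence an inequality only.\<close>

lemma card_trajectory_translate:
  fixes \<alpha> :: "'s::semigroup_mult \<Rightarrow> 'a::ab_group_add \<Rightarrow> 'a"
  assumes "inj (\<lambda>x. s * x)" "left_action UNIV \<alpha>" "finite E" "finite X"
  shows "card (trajectory \<alpha> X ((\<lambda>x. s * x) ` E)) \<le> card (trajectory \<alpha> X E)"
proof -
  have add: "\<alpha> s (x + y) = \<alpha> s x + \<alpha> s y" and mult: "\<alpha> (s * t) x = \<alpha> s (\<alpha> t x)" for x y t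
    using assms(2) unfolding left_action_def by blast+
  have zero: "\<alpha> s 0 = 0" using add[of 0 0] by simp
  have plus: "\<alpha> s ` (P + Q) = \<alpha> s ` P + \<alpha> s ` Q" for P Q
    by (auto simp: set_plus_def image_iff add) (metis add)+
  have "trajectory \<alpha> X ((\<lambda>x. s * x) ` E) = (\<Sum>e\<in>E. \<alpha> (s * e) ` X)"
    unfolding trajectory_def using assms(1)
    by (subst sum.reindex) (auto intro: inj_on_subset)
  also have "\<dots> = \<alpha> s ` trajectory \<alpha> X E"
    unfolding trajectory_def using assms(3)
    by (induction E rule: finite_induct) (auto simp: plus zero mult image_image)
  finally show ?thesis
    using assms(4) by (simp add: card_image_le finite_set_sum trajectory_def)
qed

text \<open>Both sets have the same size, so the Folner condition also counts the points of
  \<open>F\<close> missed by the translate.\<close>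

lemma card_diff_right_translate:
  fixes F :: "'s::semigroup_mult set"
  assumes "inj (\<lambda>x. x * s)" "finite F"
  shows "card (F - (\<lambda>x. x * s) ` F) = card ((\<lambda>x. x * s) ` F - F)"
proof -
  have "card ((\<lambda>x. x * s) ` F) = card F"
    using assms(1) by (intro card_image) (auto intro: inj_on_subset)
  then show ?thesis
    using assms(2) by (simp add: card_Diff_subset_Int Int_commute)
qed

section \<open>Folner sets and existence of the limit\<close>

text \<open>Double counting of the weight \<open>w (s * e)\<close> over pairs with \<open>s\<close>
  in \<open>F\<close>, \<open>e\<close> in \<open>E\<close> and \<open>s * e\<close> in
  \<open>F\<close>: summing over \<open>e\<close> first gives the upper bound, over \<open>s\<close>
  first the lower bound with the error term.\<close>

lemma trajectory_folner_bound:
  fixes \<alpha> :: "'s::semigroup_mult \<Rightarrow> 'a::ab_group_add \<Rightarrow> 'a"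
  assumes canc: "cancellative TYPE('s)" and act: "left_action UNIV \<alpha>"
    and X: "finite X" "X \<noteq> {}" and F: "finite F" and E: "finite E"
  shows "real (card E) * ln (real (card (trajectory \<alpha> X F)))
    \<le> real (card F) * ln (real (card (trajectory \<alpha> X E)))
      + ln (real (card X)) * (\<Sum>e\<in>E. real (card ((\<lambda>x. x * e) ` F - F)))"
proof -
  have injl: "inj (\<lambda>x. s * x)" and injr: "inj (\<lambda>x. x * s)" for s :: 's
    using canc unfolding cancellative_def by blast+
  define f where "f G = ln (real (card (trajectory \<alpha> X G)))" for G
  obtain w where w: "\<And>t. t \<in> F \<Longrightarrow> w t \<ge> 0" "sum w F = f F" "\<And>C. C \<subseteq> F \<Longrightarrow> sum w C \<le> f C"
    unfolding f_def trajectory_def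
    using set_sum_weights[of F "\<lambda>s. \<alpha> s ` X"] F X by blast
  have w_le: "w t \<le> ln (real (card X))" if "t \<in> F" for t
  proof -
    have "w t \<le> f {t}" using w(3)[of "{t}"] that by simp
    also have "\<dots> \<le> ln (real (card X))"
      unfolding f_def using card_trajectory_pos[OF X, of \<alpha> "{t}"] card_image_le[OF X(1), of "\<alpha> t"]
      by (simp add: trajectory_def)
    finally show ?thesis .
  qed
  have "sum w (F \<inter> (\<lambda>x. s * x) ` E) \<le> f E" for s
  proof -
    have "card (trajectory \<alpha> X (F \<inter> (\<lambda>x. s * x) ` E)) \<le> card (trajectory \<alpha> X ((\<lambda>x. s * x) ` E))"
      unfolding trajectory_def using X E by (intro card_set_sum_mono) auto
    also have "\<dots> \<le> card (trajectory \<alpha> X E)"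
      using card_trajectory_translate[OF injl act E X(1)] .
    finally have "f (F \<inter> (\<lambda>x. s * x) ` E) \<le> f E"
      unfolding f_def using card_trajectory_pos[OF X, of \<alpha>] by simp
    then show ?thesis using w(3)[of "F \<inter> (\<lambda>x. s * x) ` E"] by simp
  qed
  then have "(\<Sum>s\<in>F. sum w (F \<inter> (\<lambda>x. s * x) ` E)) \<le> real (card F) * f E"
    by (intro sum_bounded_above)
  \<comment> \<open>Left cancellation lets the points of \<open>s E\<close> be indexed by
    \<open>e\<close>, right cancellation those of \<open>F e\<close> by \<open>s\<close>.\<close>
  moreover have "(\<Sum>s\<in>F. sum w (F \<inter> (\<lambda>x. s * x) ` E)) = (\<Sum>e\<in>E. sum w (F \<inter> (\<lambda>x. x * e) ` F))"
  proof -
    have "sum w (F \<inter> (\<lambda>x. s * x) ` E) = (\<Sum>e\<in>E. if s * e \<in> F then w (s * e) else 0)" for s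
    proof -
      have "sum w (F \<inter> (\<lambda>x. s * x) ` E) = (\<Sum>t\<in>(\<lambda>x. s * x) ` E. if t \<in> F then w t else 0)"
        using sum.inter_restrict[of "(\<lambda>x. s * x) ` E" w F] E by (simp add: Int_commute)
      also have "\<dots> = (\<Sum>e\<in>E. if s * e \<in> F then w (s * e) else 0)"
        using injl[of s] by (subst sum.reindex) (auto intro: inj_on_subset)
      finally show ?thesis .
    qed
    moreover have "sum w (F \<inter> (\<lambda>x. x * e) ` F) = (\<Sum>s\<in>F. if s * e \<in> F then w (s * e) else 0)" for e
    proof -
      have "sum w (F \<inter> (\<lambda>x. x * e) ` F) = (\<Sum>t\<in>(\<lambda>x. x * e) ` F. if t \<in> F then w t else 0)"
        using sum.inter_restrict[of "(\<lambda>x. x * e) ` F" w F] F by (simp add: Int_commute)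
      also have "\<dots> = (\<Sum>s\<in>F. if s * e \<in> F then w (s * e) else 0)"
        using injr[of e] by (subst sum.reindex) (auto intro: inj_on_subset)
      finally show ?thesis .
    qed
    ultimately show ?thesis by (simp add: sum.swap[of _ E])
  qed
  \<comment> \<open>For each \<open>e\<close>, only the points of \<open>F\<close> outside
    \<open>F e\<close> lose their weight, at most \<open>ln (card X)\<close> apiece.\<close>
  moreover have "f F - ln (real (card X)) * real (card ((\<lambda>x. x * e) ` F - F))
      \<le> sum w (F \<inter> (\<lambda>x. x * e) ` F)" for e
  proof -
    have "f F = sum w (F \<inter> (\<lambda>x. x * e) ` F) + sum w (F - (\<lambda>x. x * e) ` F)"
      using sum.Int_Diff[OF F, of w] w(2) by simp
    moreover have "sum w (F - (\<lambda>x. x * e) ` F) \<le> real (card (F - (\<lambda>x. x * e) ` F)) * ln (real (card X))"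
      using w_le by (intro sum_bounded_above) auto
    ultimately show ?thesis by (simp add: card_diff_right_translate[OF injr F] mult.commute)
  qed
  then have "(\<Sum>e\<in>E. f F - ln (real (card X)) * real (card ((\<lambda>x. x * e) ` F - F)))
      \<le> (\<Sum>e\<in>E. sum w (F \<inter> (\<lambda>x. x * e) ` F))"
    by (intro sum_mono)
  ultimately show ?thesis
    by (simp add: f_def sum_subtractf sum_distrib_left)
qed

text \<open>The limit is the infimum of \<open>q\<close> over \<open>A\<close>. No value of
  \<open>q\<close> on \<open>A\<close> lies below it, and a nearly optimal fixed \<open>E\<close>
  bounds \<open>q F\<close> from above for all sufficiently invariant \<open>F\<close>.\<close>

lemma trajectory_limit_exists:
  fixes \<alpha> :: "'s::semigroup_mult \<Rightarrow> 'a::ab_group_add \<Rightarrow> 'a"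
  assumes canc: "cancellative TYPE('s)" and act: "left_action UNIV \<alpha>"
    and X: "finite X" "X \<noteq> {}"
  shows "\<exists>h. \<forall>N. right_Folner N \<longrightarrow>
    ((\<lambda>F. ln (real (card (trajectory \<alpha> X F))) / real (card F)) \<longlongrightarrow> h) N"
proof -
  define q where "q F = ln (real (card (trajectory \<alpha> X F))) / real (card F)" for F
  define A where "A = {E :: 's set. finite E \<and> E \<noteq> {}}"
  have q_nonneg: "q F \<ge> 0" for F
    using card_trajectory_pos[OF X, of \<alpha> F] unfolding q_def by simp
  have bdd: "bdd_below (q ` A)" using q_nonneg by (intro bdd_belowI[of _ 0]) auto
  have neA: "q ` A \<noteq> {}" unfolding A_def by auto
  have "(q \<longlongrightarrow> Inf (q ` A)) N" if N: "right_Folner N" for N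
  proof (rule order_tendstoI)
    have ev: "\<forall>\<^sub>F F in N. finite F \<and> F \<noteq> {}" using N unfolding right_Folner_def by blast
    fix a assume a: "a < Inf (q ` A)"
    show "\<forall>\<^sub>F F in N. a < q F"
      using ev
    proof eventually_elim
      case (elim F)
      then have "Inf (q ` A) \<le> q F" using bdd by (intro cInf_lower) (auto simp: A_def)
      with a show ?case by simp
    qed
  next
    have ev: "\<forall>\<^sub>F F in N. finite F \<and> F \<noteq> {}" using N unfolding right_Folner_def by blast
    fix a assume "Inf (q ` A) < a"
    then obtain E where E: "finite E" "E \<noteq> {}" "q E < a"
      using cInf_less_iff[OF neA bdd] unfolding A_def by auto
    have cE: "real (card E) > 0" using E by (simp add: card_gt_0_iff)
    \<comment> \<open>This is the bound of \<open>trajectory_folner_bound\<close> divided by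
      \<open>card E * card F\<close>. As \<open>E\<close> is fixed, finitely many error terms tend
      to 0.\<close>
    define b where "b F = q E + ln (real (card X)) / real (card E)
      * (\<Sum>e\<in>E. real (card ((\<lambda>x. x * e) ` F - F)) / real (card F))" for F
    have "(b \<longlongrightarrow> q E + ln (real (card X)) / real (card E) * (\<Sum>e\<in>E. 0)) N"
      unfolding b_def using N unfolding right_Folner_def
      by (intro tendsto_add tendsto_mult tendsto_const tendsto_sum) blast
    then have "(b \<longlongrightarrow> q E) N" by simp
    then have "\<forall>\<^sub>F F in N. b F < a" using E(3) by (rule order_tendstoD)
    with ev show "\<forall>\<^sub>F F in N. q F < a"
    proof eventually_elim
      case (elim F)
      then have cF: "real (card F) > 0" by (simp add: card_gt_0_iff)
      have "q F \<le> b F"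
        using trajectory_folner_bound[OF canc act X _ E(1), of F] elim cE cF
        unfolding q_def b_def by (simp add: field_simps flip: sum_divide_distrib)
      with elim show ?case by simp
    qed
  qed
  then show ?thesis unfolding q_def by blast
qed

text \<open>The filter \<open>N\<close> also yields uniqueness: it is proper, so limits along it are
  unique and the definite description in \<open>H_alg\<close> denotes the common limit.\<close>

lemma H_alg_tendsto:
  fixes \<alpha> :: "'s::semigroup_mult \<Rightarrow> 'a::ab_group_add \<Rightarrow> 'a"
  assumes "cancellative TYPE('s)" "left_action UNIV \<alpha>" "finite X" "X \<noteq> {}"
    and N: "right_Folner N"
  shows "((\<lambda>F. ln (real (card (trajectory \<alpha> X F))) / real (card F)) \<longlongrightarrow> H_alg \<alpha> X) N"
proof -
  obtain h where h: "\<forall>N. right_Folner N \<longrightarrow>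
      ((\<lambda>F. ln (real (card (trajectory \<alpha> X F))) / real (card F)) \<longlongrightarrow> h) N"
    using trajectory_limit_exists[OF assms(1-4)] by blast
  have "H_alg \<alpha> X = h"
    unfolding H_alg_def
  proof (rule the_equality, rule h)
    fix h' assume "\<forall>N. right_Folner N \<longrightarrow>
      ((\<lambda>F. ln (real (card (trajectory \<alpha> X F))) / real (card F)) \<longlongrightarrow> h') N"
    moreover have "N \<noteq> bot" using N unfolding right_Folner_def by blast
    ultimately show "h' = h" using N h tendsto_unique by blast
  qed
  with h N show ?thesis by simp
qed

lemma H_alg_mono:
  fixes \<alpha> :: "'s::semigroup_mult \<Rightarrow> 'a::ab_group_add \<Rightarrow> 'a"
  assumes "cancellative TYPE('s)" "left_action UNIV \<alpha>" "finite Y" "X \<subseteq> Y" "X \<noteq> {}"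
  shows "H_alg \<alpha> X \<le> H_alg \<alpha> Y"
proof (cases "\<exists>N :: 's set filter. right_Folner N")
  case True
  then obtain N :: "'s set filter" where N: "right_Folner N" by blast
  have X: "finite X" and Y: "Y \<noteq> {}" using assms finite_subset by auto
  have "ln (real (card (trajectory \<alpha> X F))) / real (card F)
      \<le> ln (real (card (trajectory \<alpha> Y F))) / real (card F)" for F
    using card_trajectory_mono[OF assms(3,4), of \<alpha> F] card_trajectory_pos[OF X assms(5), of \<alpha> F]
    by (intro divide_right_mono) auto
  then show ?thesis
    using tendsto_le[OF _ H_alg_tendsto[OF assms(1,2,3) Y N] H_alg_tendsto[OF assms(1,2) X assms(5) N]] N
    by (simp add: right_Folner_def)
next
  case False
  text \<open>Without Folner nets both sides are the same unspecified real number.\<close>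
  then show ?thesis by (simp add: H_alg_def)
qed

section \<open>Torsion elements and finite subgroups\<close>

lemma sum_const_add:
  fixes x :: "'a::ab_group_add"
  shows "(\<Sum>i<m + n. x) = (\<Sum>i<m. x) + (\<Sum>i<(n::nat). x)"
  by (induction n) (simp_all add: add.assoc)

lemma sum_const_mult_eq_0:
  fixes x :: "'a::ab_group_add"
  assumes "(\<Sum>i<n. x) = 0"
  shows "(\<Sum>i<n * (m::nat). x) = 0"
  using assms by (induction m) (simp_all add: sum_const_add)

text \<open>By the pigeonhole principle two multiples of \<open>x\<close> coincide, and the
  difference of their indices annihilates \<open>x\<close>.\<close>

lemma finite_add_subgroup_subset_torsion:
  fixes B :: "'a::ab_group_add set"
  assumes "finite B" "add_subgroup B"
  shows "B \<subseteq> torsion"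
proof
  fix x assume x: "x \<in> B"
  have "(\<Sum>i<n. x) \<in> B" for n :: nat
    using x assms(2) by (induction n) (auto simp: add_subgroup_def)
  then have "range (\<lambda>n::nat. \<Sum>i<n. x) \<subseteq> B" by (rule image_subsetI)
  then have "finite (range (\<lambda>n::nat. \<Sum>i<n. x))" using assms(1) by (rule finite_subset)
  then have "\<not> inj (\<lambda>n::nat. \<Sum>i<n. x)"
    using range_inj_infinite by metis
  then obtain m n :: nat where mn: "m < n" "(\<Sum>i<m. x) = (\<Sum>i<n. x)"
    using linorder_injI[of "\<lambda>n::nat. \<Sum>i<n. x"] by blast
  have "(\<Sum>i<m. x) = (\<Sum>i<m + (n - m). x)" using mn by simp
  also have "\<dots> = (\<Sum>i<m. x) + (\<Sum>i<n - m. x)" by (rule sum_const_add)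
  finally have "(\<Sum>i<n - m. x) = 0" by simp
  with mn show "x \<in> torsion" unfolding torsion_def by (auto intro!: exI[of _ "n - m"])
qed

text \<open>The natural multiples of \<open>x\<close> already form a group: reduction modulo the
  annihilating \<open>n\<close> makes them finite in number.\<close>

lemma finite_cyclic_add_subgroup:
  fixes x :: "'a::ab_group_add"
  assumes "x \<in> torsion"
  shows "\<exists>B. finite B \<and> add_subgroup B \<and> x \<in> B"
proof -
  obtain n :: nat where n: "n > 0" "(\<Sum>i<n. x) = 0"
    using assms unfolding torsion_def by blast
  define B where "B = range (\<lambda>k::nat. \<Sum>i<k. x)"
  have B: "(\<Sum>i<k. x) \<in> B" for k :: nat unfolding B_def by auto
  have "B \<subseteq> (\<lambda>k. \<Sum>i<k. x) ` {..<n}"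
  proof
    fix y assume "y \<in> B"
    then obtain k :: nat where y: "y = (\<Sum>i<k. x)" unfolding B_def by blast
    also have "\<dots> = (\<Sum>i<n * (k div n) + k mod n. x)"
      by (simp only: mult_div_mod_eq)
    also have "\<dots> = (\<Sum>i<k mod n. x)"
      by (simp only: sum_const_add sum_const_mult_eq_0[OF n(2)] add_0_left)
    finally show "y \<in> (\<lambda>k. \<Sum>i<k. x) ` {..<n}"
      using n(1) by (intro image_eqI[of _ _ "k mod n"]) simp_all
  qed
  then have "finite B" by (rule finite_subset) simp
  moreover have "- y \<in> B" if "y \<in> B" for y
  proof -
    from that obtain k :: nat where y: "y = (\<Sum>i<k. x)" unfolding B_def by blast
    \<comment> \<open>The inverse of the \<open>k\<close>-th multiple is the
      \<open>(n - 1) * k\<close>-th one, which avoids negative multiples.\<close>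
    have "k + (n - 1) * k = n * k" using n(1) by (cases n) auto
    then have "y + (\<Sum>i<(n - 1) * k. x) = 0"
      using sum_const_mult_eq_0[OF n(2), of k] unfolding y by (simp only: flip: sum_const_add)
    then have "- y = (\<Sum>i<(n - 1) * k. x)" by (rule minus_unique)
    then show ?thesis by (simp only: B)
  qed
  moreover have "y + z \<in> B" if yz: "y \<in> B" "z \<in> B" for y z
  proof -
    from yz obtain k l :: nat where "y = (\<Sum>i<k. x)" "z = (\<Sum>i<l. x)" unfolding B_def by blast
    then show ?thesis by (simp only: B flip: sum_const_add)
  qed
  moreover have "0 \<in> B" using B[of 0] by simp
  moreover have "x \<in> B" using B[of 1] by simp
  ultimately show ?thesis unfolding add_subgroup_def by blast
qed

lemma add_subgroup_plus:
  fixes B C :: "'a::ab_group_add set"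
  assumes "add_subgroup B" "add_subgroup C"
  shows "add_subgroup (B + C)"
  unfolding add_subgroup_def
proof (intro conjI ballI)
  show "0 \<in> B + C" using assms set_plus_intro[of 0 B 0 C] by (simp add: add_subgroup_def)
next
  fix x y assume "x \<in> B + C" "y \<in> B + C"
  then obtain b c b' c' where *: "x = b + c" "y = b' + c'" "b \<in> B" "b' \<in> B" "c \<in> C" "c' \<in> C"
    by (auto elim!: set_plus_elim)
  then have "x + y = (b + b') + (c + c')" by (simp add: ac_simps)
  with * assms show "x + y \<in> B + C" unfolding add_subgroup_def by (metis set_plus_intro)
next
  fix x assume "x \<in> B + C"
  then obtain b c where *: "x = b + c" "b \<in> B" "c \<in> C" by (auto elim!: set_plus_elim)
  then have "- x = - b + - c" by simp
  with * assms show "- x \<in> B + C" unfolding add_subgroup_def by (metis set_plus_intro)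
qed

text \<open>Finite cyclic subgroups are added one at a time; a sum of two finite subgroups is again
  finite, and contains both because each contains 0.\<close>

lemma finite_torsion_subset_subgroup:
  fixes X :: "'a::ab_group_add set"
  assumes "finite X" "X \<subseteq> torsion"
  shows "\<exists>B. finite B \<and> add_subgroup B \<and> X \<subseteq> B"
  using assms
proof (induction X rule: finite_induct)
  case empty
  have "add_subgroup {0 :: 'a}" by (simp add: add_subgroup_def)
  then show ?case by blast
next
  case (insert x X)
  then obtain B where B: "finite B" "add_subgroup B" "X \<subseteq> B" by auto
  obtain C where C: "finite C" "add_subgroup C" "x \<in> C"
    using finite_cyclic_add_subgroup insert.prems by auto
  have "B \<subseteq> B + C" "C \<subseteq> B + C"
    using B(2) C(2) set_zero_plus2[of C B] set_zero_plus2[of B C]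
    by (auto simp: add_subgroup_def add.commute)
  with B C show ?case
    by (intro exI[of _ "B + C"]) (auto intro: finite_set_plus add_subgroup_plus)
qed

theorem proposition4p5:
  fixes \<alpha> :: "'s::semigroup_mult \<Rightarrow> 'a::ab_group_add \<Rightarrow> 'a"
  assumes "cancellative TYPE('s)" and "right_amenable TYPE('s)"
    and "left_action UNIV \<alpha>"
  shows "ent UNIV \<alpha> = ent torsion \<alpha> \<and> ent torsion \<alpha> = h_alg torsion \<alpha>"
proof (intro conjI antisym)
  \<comment> \<open>The two suprema defining \<open>ent\<close> thus range over the same family of
    subgroups.\<close>
  have "{X. finite X \<and> add_subgroup X \<and> X \<subseteq> UNIV} =
      {X :: 'a set. finite X \<and> add_subgroup X \<and> X \<subseteq> torsion}"
    using finite_add_subgroup_subset_torsion by blast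
  then show "ent UNIV \<alpha> \<le> ent torsion \<alpha>" "ent torsion \<alpha> \<le> ent UNIV \<alpha>"
    unfolding ent_def by simp_all
  show "ent torsion \<alpha> \<le> h_alg torsion \<alpha>"
    unfolding ent_def h_alg_def by (intro SUP_subset_mono) (auto simp: add_subgroup_def)
  show "h_alg torsion \<alpha> \<le> ent torsion \<alpha>"
    unfolding h_alg_def
  proof (rule SUP_least)
    fix X :: "'a set" assume "X \<in> {X. finite X \<and> X \<noteq> {} \<and> X \<subseteq> torsion}"
    then have X: "finite X" "X \<noteq> {}" "X \<subseteq> torsion" by auto
    then obtain B where B: "finite B" "add_subgroup B" "X \<subseteq> B"
      using finite_torsion_subset_subgroup by blast
    have "ereal (H_alg \<alpha> X) \<le> ereal (H_alg \<alpha> B)"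
      using H_alg_mono[OF assms(1,3) B(1,3) X(2)] by simp
    also have "\<dots> \<le> ent torsion \<alpha>"
      unfolding ent_def using B finite_add_subgroup_subset_torsion by (intro SUP_upper) auto
    finally show "ereal (H_alg \<alpha> X) \<le> ent torsion \<alpha>" .
  qed
qed

end
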